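(* Let $\alpha=\frac{1+\sqrt5}{2}$ and $c_n=\cos(2n\arctan\alpha)$. If $n$ is a positive integer and $p$, $q$, $r$ and $s$ are any integers, then, with all sums over $k$ from $0$ to $n$, \[ \begin{split} 50\sum_{k} \binom{2n}{2k} F_{k + p} F_{k + q} F_{k + r} F_{k + s} &= (5^n + 1)L_{2n + p + q + r + s} - ( - 1)^s 2\cdot 5^{n/2} L_{n + p + q + r - s} c_n\\ &\quad- 2\cdot 5^{n/2} c_n \big((-1)^r L_{n + p + q - r + s} + ( - 1)^q L_{p - q} L_{n + r + s}\big)\\ &\quad+ (-1)^s 4^n\big((- 1)^{r} L_{p + q - r - s} + ( - 1)^{q} L_{p - q} L_{r - s}\big), \end{split} \] \[ \begin{split} 10\sum_{k} \binom{2n}{2k}L_{k + p} F_{k + q} F_{k + r} F_{k + s} &= (5^n + 1)F_{2n + p + q + r + s} - ( - 1)^s 2\cdot 5^{n/2} F_{n + p + q + r - s} c_n\\ &\quad- 2\cdot 5^{n/2} c_n\big(( - 1)^r F_{n + p + q - r + s} + ( - 1)^q F_{p - q} L_{n + r + s}\big)\\ &\quad + (-1)^s 4^n\big(( - 1)^{r} F_{p + q - r - s} + ( - 1)^{q} F_{p - q} L_{r - s}\big), \end{split} \] \[ \begin{split} 10\sum_{k} \binom{2n}{2k} L_{k + p} L_{k + q} F_{k + r} F_{k + s} &= (5^n + 1)L_{2n + p + q + r + s} - ( - 1)^s2\cdot 5^{n/2} L_{n + p + q + r - s} c_n\\ &\quad- 2\cdot5^{n/2}c_n \big(( - 1)^r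 L_{n + p + q - r + s} - ( - 1)^q L_{p - q} L_{n + r + s}\big)\\ &\quad +(-1)^s4^n\big( ( - 1)^{r} L_{p + q - r - s} - ( - 1)^{q} L_{p - q} L_{r - s}\big), \end{split} \] \[ \begin{split} 2\sum_{k} \binom{2n}{2k} L_{k + p} L_{k + q} L_{k + r} F_{k + s} &= (5^n + 1)F_{2n + p + q + r + s} - ( - 1)^s 2\cdot 5^{n/2} F_{n + p + q + r - s} c_n\\ &\quad+2\cdot 5^{n/2}c_n \big( ( - 1)^r F_{n + p + q - r + s} + ( - 1)^q L_{p - q} F_{n + r + s}\big)\\ &\quad - (-1)^s 4^n \big(( - 1)^{r} F_{p + q - r - s} + ( - 1)^{q} L_{p - q} F_{r - s}\big), \end{split} \] \[ \begin{split} 2\sum_{k} \binom{2n}{2k}L_{k + p} L_{k + q} L_{k + r} L_{k + s} &= (5^n + 1)L_{2n + p + q + r + s} + ( - 1)^s2\cdot 5^{n/2} L_{n + p + q + r - s} c_n\\ &\quad+ 2\cdot 5^{n/2}c_n \big(( - 1)^r L_{n + p + q - r + s} + ( - 1)^q L_{p - q} L_{n + r + s}\big)\\ &\quad + (-1)^s4^n\big(( - 1)^{r} L_{p + q - r - s} + ( - 1)^{q} L_{p - q} L_{r - s}\big). \end{split} \]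
   Context: The Fibonacci numbers $F_j$ and Lucas numbers $L_j$ are defined for all integers $j$ by $F_0=0$, $F_1=1$, $L_0=2$, $L_1=1$, $F_j=F_{j-1}+F_{j-2}$, $L_j=L_{j-1}+L_{j-2}$, with $F_{-j}=(-1)^{j-1}F_j$ and $L_{-j}=(-1)^jL_j$. Here $\arctan$ is the real arctangent. *)

theory Defs
  imports "HOL-Analysis.Analysis" "HOL-Number_Theory.Fib"
begin

definition fibZ :: "int \<Rightarrow> int" where
  "fibZ j = (if 0 \<le> j then int (fib (nat j)) else (-1) ^ nat (- j - 1) * int (fib (nat (- j))))"

fun lucas :: "nat \<Rightarrow> nat" where
  "lucas 0 = 2"
| "lucas (Suc 0) = 1"
| "lucas (Suc (Suc n)) = lucas (Suc n) + lucas n"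

definition lucasZ :: "int \<Rightarrow> int" where
  "lucasZ j = (if 0 \<le> j then int (lucas (nat j)) else (-1) ^ nat (- j) * int (lucas (nat (- j))))"

lemma int_cases3:
  fixes j :: int
  obtains n where "j = int n + 2" | "j = 1" | "j = 0" | n where "j = - int n - 1"
proof (cases "j \<ge> 2")
  case True
  then have "j = int (nat (j - 2)) + 2" by simp
  then show thesis using that(1) by blast
next
  case False
  show thesis
  proof (cases "j < 0")
    case True
    then have "j = - int (nat (- j - 1)) - 1" by simp
    then show thesis using that(4) by blast
  next
    case F: False
    with False have "j = 0 \<or> j = 1" by linarith
    then show thesis using that(2,3) by blast
  qed
qed

lemma fibZ_rec: "fibZ j = fibZ (j - 1) + fibZ (j - 2)"
proof (cases j rule: int_cases3)
  case (1 n)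
  have "nat (int n + 2) = Suc (Suc n)" "nat (1 + int n) = Suc n" by simp_all
  with 1 show ?thesis by (simp add: fibZ_def)
next
  case (4 n)
  have "nat (- j) = Suc n" "nat (1 - j) = Suc (Suc n)" "nat (2 - j) = Suc (Suc (Suc n))"
    "nat (- j - 1) = n"
    and "j < 0"
    using 4 by simp_all
  then show ?thesis by (simp add: fibZ_def algebra_simps)
qed (simp_all add: fibZ_def)

lemma lucasZ_rec: "lucasZ j = lucasZ (j - 1) + lucasZ (j - 2)"
proof (cases j rule: int_cases3)
  case (1 n)
  have "nat (int n + 2) = Suc (Suc n)" "nat (1 + int n) = Suc n" by simp_all
  with 1 show ?thesis by (simp add: lucasZ_def)
next
  case (4 n)
  have "nat (- j) = Suc n" "nat (1 - j) = Suc (Suc n)" "nat (2 - j) = Suc (Suc (Suc n))"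
    and "j < 0"
    using 4 by simp_all
  then show ?thesis by (simp add: lucasZ_def algebra_simps)
qed (simp_all add: lucasZ_def numeral_2_eq_2)

lemma fibZ_0_1: "fibZ 0 = 0" "fibZ 1 = 1"
  by (simp_all add: fibZ_def)

lemma lucasZ_0_1: "lucasZ 0 = 2" "lucasZ 1 = 1"
  by (simp_all add: lucasZ_def)

end

theory Submission
  imports Defs
begin

text \<open>
  By Binet's formulas each product of four factors expands into monomials in \<open>\<phi>\<^sup>k\<close> and
  \<open>\<psi>\<^sup>k\<close>, where \<open>\<phi> \<psi> = -1\<close>. So only the sums of \<open>(2n choose 2k) x\<^sup>k\<close> at the five points
  \<open>x = \<phi>\<^sup>4, \<psi>\<^sup>4, -\<phi>\<^sup>2, -\<psi>\<^sup>2, 1\<close> occur. Each is half of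
  \<open>(1 + z)\<^bsup>2n\<^esup> + (1 - z)\<^bsup>2n\<^esup>\<close> with \<open>z\<^sup>2 = x\<close>. For negative \<open>x = -y\<^sup>2\<close> the polar form
  of \<open>1 + \<i> y\<close> produces the cosine, and \<open>1 + \<phi>\<^sup>2 = \<phi> \<surd>5\<close> produces the powers of 5.
\<close>

section \<open>The golden ratio and its conjugate\<close>

definition phi :: real where "phi = (1 + sqrt 5) / 2"
definition psi :: real where "psi = (1 - sqrt 5) / 2"

lemma phi_pos: "phi > 0"
  by (simp add: phi_def add_pos_pos)

lemma phi_psi: "phi * psi = -1" and phi_psi_sum: "phi + psi = 1" and phi_psi_diff: "phi - psi = sqrt 5"
  by (simp_all add: phi_def psi_def field_simps)

lemma psi_nonzero: "psi \<noteq> 0"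
  using phi_psi by auto

lemma phi_square: "phi\<^sup>2 = phi + 1" and psi_square: "psi\<^sup>2 = psi + 1"
  by (simp_all add: phi_def psi_def power2_eq_square field_simps)

lemma one_plus_phi_square: "1 + phi\<^sup>2 = sqrt 5 * phi"
  by (simp add: phi_def power2_eq_square field_simps)

text \<open>\<open>psi\<close> is negative, whence the sign. It later produces a factor
  \<open>(-1) ^ n\<close> that cancels the one in \<open>cos_arctan_psi\<close>.\<close>

lemma one_plus_psi_square: "1 + psi\<^sup>2 = - (sqrt 5 * psi)"
  by (simp add: psi_def power2_eq_square field_simps)

lemma psi_eq: "psi = - (1 / phi)"
  using phi_psi phi_pos by (simp add: field_simps)

section \<open>Binet's formulas on all integers\<close>

text \<open>Induction fitted to a second-order recurrence, run forwards and backwards. The pair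
  \<open>P j \<and> P (j + 1)\<close> is the invariant that reduces it to ordinary induction from 0
  in both directions.\<close>

lemma int_two_step_induct:
  fixes j :: int
  assumes "P 0" "P 1"
    and "\<And>i. P i \<Longrightarrow> P (i + 1) \<Longrightarrow> P (i + 2)"
    and "\<And>i. P (i + 1) \<Longrightarrow> P (i + 2) \<Longrightarrow> P i"
  shows "P j"
proof -
  have "P j \<and> P (j + 1)"
  proof (induction j rule: int_induct [where k = 0])
    case base
    show ?case using assms(1,2) by simp
  next
    case (step1 i)
    then show ?case using assms(3)[of i] by (simp add: add.assoc)
  next
    case (step2 i)
    then show ?case using assms(4)[of "i - 1"] by (simp add: algebra_simps)
  qed
  then show ?thesis ..
qed

lemma powi_two_step:
  fixes x :: real
  assumes "x \<noteq> 0" "x\<^sup>2 = x + 1"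
  shows "x powi (i + 2) = x powi (i + 1) + x powi i"
  using assms by (simp add: power_int_add algebra_simps)

text \<open>Both sides obey the same recurrence and agree at 0 and 1. The factor
  \<open>sqrt 5\<close> stays on the left to avoid division.\<close>

lemma fibZ_binet: "sqrt 5 * real_of_int (fibZ j) = phi powi j - psi powi j"
proof (induction j rule: int_two_step_induct)
  case 1 show ?case by (simp add: fibZ_0_1)
next
  case 2 show ?case by (simp add: fibZ_0_1 phi_psi_diff)
next
  case (3 i)
  then show ?case
    using fibZ_rec[of "i + 2"] powi_two_step[of phi i] powi_two_step[of psi i]
      phi_pos psi_nonzero phi_square psi_square
    by (simp add: algebra_simps)
next
  case (4 i)
  then show ?case
    using fibZ_rec[of "i + 2"] powi_two_step[of phi i] powi_two_step[of psi i]
      phi_pos psi_nonzero phi_square psi_square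
    by (simp add: algebra_simps)
qed

lemma lucasZ_binet: "real_of_int (lucasZ j) = phi powi j + psi powi j"
proof (induction j rule: int_two_step_induct)
  case 1 show ?case by (simp add: lucasZ_0_1)
next
  case 2 show ?case by (simp add: lucasZ_0_1 phi_psi_sum)
next
  case (3 i)
  then show ?case
    using lucasZ_rec[of "i + 2"] powi_two_step[of phi i] powi_two_step[of psi i]
      phi_pos psi_nonzero phi_square psi_square
    by (simp add: algebra_simps)
next
  case (4 i)
  then show ?case
    using lucasZ_rec[of "i + 2"] powi_two_step[of phi i] powi_two_step[of psi i]
      phi_pos psi_nonzero phi_square psi_square
    by (simp add: algebra_simps)
qed

section \<open>Negative exponents and signs\<close>

lemma phi_psi_powi: "phi powi j * psi powi j = (-1) powi j"
  by (metis phi_psi power_int_mult_distrib)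

lemma minus_one_powi_square: "(-1) powi j * (-1) powi j = (1::real)"
  by (simp flip: power_int_mult_distrib)

text \<open>Since \<open>phi * psi = -1\<close>, the inverse of one root is minus the other. A
  negative exponent can thus be traded for a positive one of the conjugate, at the price of a sign
  that is its own inverse.\<close>

lemma phi_powi_minus: "phi powi (- j) = (-1) powi j * psi powi j"
proof -
  have "phi powi (- j) * (phi powi j * psi powi j) = psi powi j"
    using phi_pos by (simp add: power_int_minus)
  then show ?thesis
    by (metis phi_psi_powi minus_one_powi_square mult.assoc mult.commute mult.right_neutral)
qed

lemma psi_powi_minus: "psi powi (- j) = (-1) powi j * phi powi j"
proof -
  have "psi powi (- j) * (phi powi j * psi powi j) = phi powi j"
    using psi_nonzero by (simp add: power_int_minus)
  then show ?thesis
    by (metis phi_psi_powi minus_one_powi_square mult.assoc mult.commute mult.right_neutral)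
qed

section \<open>Even-indexed binomial sums and their quartic combination\<close>

text \<open>The odd powers of \<open>z\<close> cancel between the two expansions and the even ones
  double. A general commutative ring is used because both real and imaginary \<open>z\<close> are
  needed.\<close>

lemma even_binomial_sum:
  fixes z :: "'a :: comm_ring_1"
  shows "2 * (\<Sum>k=0..n. of_nat ((2 * n) choose (2 * k)) * (z\<^sup>2) ^ k) = (1 + z) ^ (2 * n) + (1 - z) ^ (2 * n)"
proof -
  let ?g = "\<lambda>k. of_nat ((2 * n) choose k) * z ^ k * (1 + (-1) ^ k)"
  have "(1 + z) ^ (2 * n) + (1 - z) ^ (2 * n) = (\<Sum>k\<le>2 * n. ?g k)"
    using binomial_ring[of z 1 "2 * n"] binomial_ring[of "- z" 1 "2 * n"]
    by (simp add: sum.distrib algebra_simps power_minus[of z])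
  also have "\<dots> = (\<Sum>k\<in>(*) 2 ` {0..n}. ?g k)"
  proof (rule sum.mono_neutral_right)
    show "\<forall>k\<in>{..2 * n} - (*) 2 ` {0..n}. ?g k = 0"
    proof
      fix k assume k: "k \<in> {..2 * n} - (*) 2 ` {0..n}"
      have "odd k"
      proof
        assume "even k"
        then obtain m where "k = 2 * m" ..
        with k show False by auto
      qed
      then show "?g k = 0" by simp
    qed
  qed auto
  also have "\<dots> = (\<Sum>k=0..n. ?g (2 * k))"
    by (subst sum.reindex) (auto simp: inj_on_def)
  also have "\<dots> = 2 * (\<Sum>k=0..n. of_nat ((2 * n) choose (2 * k)) * (z\<^sup>2) ^ k)"
    by (simp add: sum_distrib_left mult_ac flip: power_mult)
  finally show ?thesis ..
qed

text \<open>For \<open>z = \<i> * y\<close> the numbers \<open>1 + z\<close> and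
  \<open>1 - z\<close> are conjugate, with modulus \<open>sqrt (1 + y\<^sup>2)\<close> and arguments
  \<open>arctan y\<close> and \<open>- arctan y\<close>. By De Moivre their powers stay conjugate,
  so they add up to twice a real part.\<close>

lemma even_binomial_sum_neg:
  fixes y :: real
  shows "(\<Sum>k=0..n. real ((2 * n) choose (2 * k)) * (- y\<^sup>2) ^ k)
    = (1 + y\<^sup>2) ^ n * cos (2 * real n * arctan y)"
proof -
  let ?R = "sqrt (1 + y\<^sup>2)"
  have pos: "?R \<noteq> 0" by (simp add: add_pos_nonneg less_imp_neq [symmetric])
  have polar: "1 + \<i> * y = ?R * cis (arctan y)" "1 - \<i> * y = ?R * cis (- arctan y)"
    using pos by (auto simp: complex_eq_iff cos_arctan sin_arctan)
  have R: "?R ^ (2 * n) = (1 + y\<^sup>2) ^ n"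
    by (simp add: power_mult)
  have "complex_of_real (2 * (\<Sum>k=0..n. real ((2 * n) choose (2 * k)) * (- y\<^sup>2) ^ k))
    = 2 * (\<Sum>k=0..n. of_nat ((2 * n) choose (2 * k)) * ((\<i> * complex_of_real y)\<^sup>2) ^ k)"
    by (simp add: power_mult_distrib)
  also have "\<dots> = (?R * cis (arctan y)) ^ (2 * n) + (?R * cis (- arctan y)) ^ (2 * n)"
    by (simp only: even_binomial_sum polar)
  also have "\<dots> = complex_of_real (?R ^ (2 * n)) * (cis (2 * n * arctan y) + cis (- (2 * n * arctan y)))"
    unfolding power_mult_distrib Complex.DeMoivre by (simp add: distrib_left)
  also have "\<dots> = complex_of_real (2 * ((1 + y\<^sup>2) ^ n * cos (2 * real n * arctan y)))"
    unfolding R by (simp add: complex_eq_iff)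
  finally show ?thesis
    by (simp only: of_real_eq_iff)
qed

text \<open>Because \<open>psi = - (1 / phi)\<close>, the two arctangents differ by
  \<open>pi / 2\<close>, so the angles here differ by \<open>n * pi\<close>. This lets a single
  cosine \<open>c\<close> serve both roots.\<close>

lemma cos_arctan_psi: "cos (2 * real n * arctan psi) = (-1) ^ n * cos (2 * real n * arctan phi)"
proof -
  have "arctan psi = arctan phi - pi / 2"
    using phi_pos arctan_inverse[of phi] by (simp add: psi_eq arctan_minus inverse_eq_divide)
  then have "2 * real n * arctan psi = 2 * real n * arctan phi - real n * pi"
    by (simp only:) (simp add: algebra_simps)
  then show ?thesis
    by (simp add: cos_diff)
qed

text \<open>
  The coefficients \<open>A\<^sub>i\<close>, \<open>B\<^sub>i\<close> stay free so that Fibonacci factors (\<open>B\<^sub>i = - \<psi>\<^sup>j\<close>, scaled by \<open>\<surd>5\<close>)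
  and Lucas factors (\<open>B\<^sub>i = \<psi>\<^sup>j\<close>) are covered at once.
\<close>
lemma even_binomial_sum_quartic:
  fixes f1 f2 f3 f4 :: "nat \<Rightarrow> real"
    and A1 A2 A3 A4 B1 B2 B3 B4 :: real
  assumes "n > 0" and c: "c = cos (2 * real n * arctan phi)"
    and f: "\<And>k. f1 k = phi ^ k * A1 + psi ^ k * B1" "\<And>k. f2 k = phi ^ k * A2 + psi ^ k * B2"
      "\<And>k. f3 k = phi ^ k * A3 + psi ^ k * B3" "\<And>k. f4 k = phi ^ k * A4 + psi ^ k * B4"
  shows "2 * (\<Sum>k=0..n. real ((2 * n) choose (2 * k)) * f1 k * f2 k * f3 k * f4 k)
    = (5 ^ n + 1) * ((phi ^ n)\<^sup>2 * (A1 * A2 * A3 * A4) + (psi ^ n)\<^sup>2 * (B1 * B2 * B3 * B4))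
      + 2 * sqrt 5 ^ n * c
        * (phi ^ n * (A1 * A2 * A3 * B4 + A1 * A2 * B3 * A4 + A1 * B2 * A3 * A4 + B1 * A2 * A3 * A4)
         + psi ^ n * (B1 * B2 * B3 * A4 + B1 * B2 * A3 * B4 + B1 * A2 * B3 * B4 + A1 * B2 * B3 * B4))
      + 4 ^ n * (A1 * A2 * B3 * B4 + A1 * B2 * A3 * B4 + A1 * B2 * B3 * A4
         + B1 * A2 * A3 * B4 + B1 * A2 * B3 * A4 + B1 * B2 * A3 * A4)"
proof -
  let ?S = "\<lambda>x::real. \<Sum>k=0..n. real ((2 * n) choose (2 * k)) * x ^ k"
  have sqrt5_even: "sqrt 5 ^ (2 * n) = 5 ^ n"
    by (simp add: power_mult)
  have minus_even: "(- x) ^ (2 * n) = x ^ (2 * n)" for x :: real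
    by simp
  \<comment> \<open>Here \<open>z = phi\<^sup>2\<close>: the factor
    \<open>1 + z = sqrt 5 * phi\<close> yields the term with \<open>5 ^ n\<close>, and
    \<open>1 - z = - phi\<close> yields the term with 1.\<close>
  have S_phi4: "2 * ?S ((phi\<^sup>2)\<^sup>2) = (5 ^ n + 1) * (phi ^ n)\<^sup>2"
  proof -
    have "1 - phi\<^sup>2 = - phi" by (simp add: phi_square)
    then have "2 * ?S ((phi\<^sup>2)\<^sup>2) = (sqrt 5 * phi) ^ (2 * n) + (- phi) ^ (2 * n)"
      using even_binomial_sum[of n "phi\<^sup>2"] one_plus_phi_square by simp
    also have "\<dots> = (5 ^ n + 1) * (phi ^ n)\<^sup>2"
      unfolding minus_even power_mult_distrib sqrt5_even by (simp add: power_even_eq distrib_right)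
    finally show ?thesis .
  qed
  have S_psi4: "2 * ?S ((psi\<^sup>2)\<^sup>2) = (5 ^ n + 1) * (psi ^ n)\<^sup>2"
  proof -
    have "1 - psi\<^sup>2 = - psi" by (simp add: psi_square)
    then have "2 * ?S ((psi\<^sup>2)\<^sup>2) = (- (sqrt 5 * psi)) ^ (2 * n) + (- psi) ^ (2 * n)"
      using even_binomial_sum[of n "psi\<^sup>2"] one_plus_psi_square by simp
    also have "\<dots> = (5 ^ n + 1) * (psi ^ n)\<^sup>2"
      unfolding minus_even power_mult_distrib sqrt5_even by (simp add: power_even_eq distrib_right)
    finally show ?thesis .
  qed
  have S_phi2: "?S (- phi\<^sup>2) = sqrt 5 ^ n * phi ^ n * c"
    by (simp add: even_binomial_sum_neg one_plus_phi_square c power_mult_distrib)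
  have S_psi2: "?S (- psi\<^sup>2) = sqrt 5 ^ n * psi ^ n * c"
  proof -
    \<comment> \<open>The sign from the negative base \<open>- (sqrt 5 * psi)\<close> cancels the
      sign from \<open>cos_arctan_psi\<close>.\<close>
    have "(- (sqrt 5 * psi)) ^ n * (-1) ^ n = (sqrt 5 * psi) ^ n"
      by (simp flip: power_mult_distrib)
    then show ?thesis
      by (simp add: even_binomial_sum_neg one_plus_psi_square cos_arctan_psi c power_mult_distrib)
  qed
  \<comment> \<open>At \<open>z = 1\<close> the second power is \<open>0 ^ (2 * n)\<close>, which
    vanishes only because \<open>n > 0\<close>.\<close>
  have S_1: "2 * ?S 1 = 4 ^ n"
    using even_binomial_sum[of n "1::real"] \<open>n > 0\<close> by (simp add: power_mult)
  \<comment> \<open>The two digits count the factors \<open>A\<close> and \<open>B\<close> in each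
    product, that is, the exponents of \<open>phi ^ k\<close> and \<open>psi ^ k\<close> that it
    multiplies.\<close>
  let ?c40 = "A1 * A2 * A3 * A4" and ?c04 = "B1 * B2 * B3 * B4"
    and ?c31 = "A1 * A2 * A3 * B4 + A1 * A2 * B3 * A4 + A1 * B2 * A3 * A4 + B1 * A2 * A3 * A4"
    and ?c13 = "B1 * B2 * B3 * A4 + B1 * B2 * A3 * B4 + B1 * A2 * B3 * B4 + A1 * B2 * B3 * B4"
    and ?c22 = "A1 * A2 * B3 * B4 + A1 * B2 * A3 * B4 + A1 * B2 * B3 * A4
         + B1 * A2 * A3 * B4 + B1 * A2 * B3 * A4 + B1 * B2 * A3 * A4"
  have "f1 k * f2 k * f3 k * f4 k
      = ((phi\<^sup>2)\<^sup>2) ^ k * ?c40 + ((psi\<^sup>2)\<^sup>2) ^ k * ?c04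
        + (- phi\<^sup>2) ^ k * ?c31 + (- psi\<^sup>2) ^ k * ?c13 + 1 ^ k * ?c22" for k
  proof -
    \<comment> \<open>Mixed monomials collapse through \<open>phi * psi = -1\<close>. Undoing the
      collapse writes all five powers as monomials in \<open>phi ^ k\<close> and
      \<open>psi ^ k\<close>, leaving a polynomial identity.\<close>
    have "phi ^ 3 * psi = phi\<^sup>2 * (phi * psi)" "psi ^ 3 * phi = psi\<^sup>2 * (phi * psi)"
      by (simp_all add: power2_eq_square power3_eq_cube)
    then have neg: "- phi\<^sup>2 = phi ^ 3 * psi" "- psi\<^sup>2 = psi ^ 3 * phi"
      by (simp_all add: phi_psi)
    have one: "1 ^ k = ((phi * psi)\<^sup>2) ^ k"
      by (simp add: phi_psi)
    have swap: "(x ^ m) ^ k = (x ^ k) ^ m" for x :: real and m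
      by (simp add: mult.commute flip: power_mult)
    have powers: "((phi\<^sup>2)\<^sup>2) ^ k = (phi ^ k) ^ 4" "((psi\<^sup>2)\<^sup>2) ^ k = (psi ^ k) ^ 4"
      "(- phi\<^sup>2) ^ k = (phi ^ k) ^ 3 * psi ^ k" "(- psi\<^sup>2) ^ k = (psi ^ k) ^ 3 * phi ^ k"
      "1 ^ k = (phi ^ k)\<^sup>2 * (psi ^ k)\<^sup>2"
      unfolding neg one power_mult_distrib swap by (simp_all add: mult.commute flip: power_mult)
    show ?thesis unfolding powers f by algebra
  qed
  then have "(\<Sum>k=0..n. real ((2 * n) choose (2 * k)) * f1 k * f2 k * f3 k * f4 k)
     = (\<Sum>k=0..n. real ((2 * n) choose (2 * k)) * (((phi\<^sup>2)\<^sup>2) ^ k * ?c40 + ((psi\<^sup>2)\<^sup>2) ^ k * ?c04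
        + (- phi\<^sup>2) ^ k * ?c31 + (- psi\<^sup>2) ^ k * ?c13 + 1 ^ k * ?c22))"
    by (simp only: mult.assoc)
  also have "\<dots> = ?S ((phi\<^sup>2)\<^sup>2) * ?c40 + ?S ((psi\<^sup>2)\<^sup>2) * ?c04
     + ?S (- phi\<^sup>2) * ?c31 + ?S (- psi\<^sup>2) * ?c13 + ?S 1 * ?c22"
    by (simp only: distrib_left sum.distrib sum_distrib_right mult.assoc)
  finally have expand: "2 * (\<Sum>k=0..n. real ((2 * n) choose (2 * k)) * f1 k * f2 k * f3 k * f4 k)
     = (2 * ?S ((phi\<^sup>2)\<^sup>2)) * ?c40 + (2 * ?S ((psi\<^sup>2)\<^sup>2)) * ?c04
     + 2 * ?S (- phi\<^sup>2) * ?c31 + 2 * ?S (- psi\<^sup>2) * ?c13 + (2 * ?S 1) * ?c22"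
    by (simp only: distrib_left mult.assoc)
  show ?thesis
    unfolding expand S_phi4 S_psi4 S_phi2 S_psi2 S_1 by algebra
qed

section \<open>Expansions at shifted and subtracted indices, and the five identities\<close>

lemma lucasZ_shift: "real_of_int (lucasZ (int k + j)) = phi ^ k * phi powi j + psi ^ k * psi powi j"
  using phi_pos psi_nonzero by (simp add: lucasZ_binet power_int_add)

text \<open>The minus sign sits inside the coefficient of \<open>psi ^ k\<close>, so that the
  equation matches the hypotheses on \<open>f1\<close> to \<open>f4\<close> of
  \<open>even_binomial_sum_quartic\<close> literally.\<close>

lemma fibZ_shift: "sqrt 5 * real_of_int (fibZ (int k + j)) = phi ^ k * phi powi j + psi ^ k * - (psi powi j)"
  using phi_pos psi_nonzero by (simp add: fibZ_binet power_int_add)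

text \<open>The negative exponent \<open>- j\<close> is exchanged for the conjugate root. The
  resulting sign is kept on the left because every sign in the five identities accompanies an index
  subtracting the same variable, so the two are absorbed together.\<close>

lemma lucasZ_diff:
  "(-1) powi j * real_of_int (lucasZ (i - j)) = phi powi i * psi powi j + psi powi i * phi powi j"
proof -
  have "real_of_int (lucasZ (i - j))
      = (-1) powi j * (phi powi i * psi powi j + psi powi i * phi powi j)"
    using power_int_add[of phi i "- j"] power_int_add[of psi i "- j"] phi_pos psi_nonzero
    by (simp add: lucasZ_binet phi_powi_minus psi_powi_minus algebra_simps)
  then show ?thesis
    by (metis minus_one_powi_square mult.assoc mult_1)
qed

lemma fibZ_diff:
  "(-1) powi j * (sqrt 5 * real_of_int (fibZ (i - j))) = phi powi i * psi powi j - psi powi i * phi powi j"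
proof -
  have "sqrt 5 * real_of_int (fibZ (i - j))
      = (-1) powi j * (phi powi i * psi powi j - psi powi i * phi powi j)"
    using power_int_add[of phi i "- j"] power_int_add[of psi i "- j"] phi_pos psi_nonzero
    unfolding fibZ_binet by (simp add: phi_powi_minus psi_powi_minus right_diff_distrib mult_ac)
  then show ?thesis
    by (metis minus_one_powi_square mult.assoc mult_1)
qed

text \<open>Each Fibonacci factor brings one \<open>sqrt 5\<close> and negates its
  \<open>psi\<close> coefficient. With 4, 3, 2, 1, 0 such factors, twice the product of the roots is
  50, \<open>10 * sqrt 5\<close>, 10, \<open>2 * sqrt 5\<close>, 2. An odd number of them turns the
  leading sum of conjugates into a difference, hence \<open>fibZ\<close> there, which absorbs the
  leftover \<open>sqrt 5\<close>.\<close>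

theorem theorem32:
  fixes n :: nat and p q r s :: int and \<alpha> c :: real
  assumes "n > 0"
    and "\<alpha> = (1 + sqrt 5) / 2"
    and "c = cos (2 * real n * arctan \<alpha>)"
  shows "(50 * (\<Sum>k=0..n. real ((2 * n) choose (2 * k)) * real_of_int (fibZ (int k + p)) * real_of_int (fibZ (int k + q)) * real_of_int (fibZ (int k + r)) * real_of_int (fibZ (int k + s)))
      = (5 ^ n + 1) * real_of_int (lucasZ (2 * int n + p + q + r + s)) - (-1) powi s * 2 * 5 powr (real n / 2) * real_of_int (lucasZ (int n + p + q + r - s)) * c
        - 2 * 5 powr (real n / 2) * c * ((-1) powi r * real_of_int (lucasZ (int n + p + q - r + s)) + (-1) powi q * real_of_int (lucasZ (p - q)) * real_of_int (lucasZ (int n + r + s)))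
        + (-1) powi s * 4 ^ n * ((-1) powi r * real_of_int (lucasZ (p + q - r - s)) + (-1) powi q * real_of_int (lucasZ (p - q)) * real_of_int (lucasZ (r - s))))
    \<and> (10 * (\<Sum>k=0..n. real ((2 * n) choose (2 * k)) * real_of_int (lucasZ (int k + p)) * real_of_int (fibZ (int k + q)) * real_of_int (fibZ (int k + r)) * real_of_int (fibZ (int k + s)))
      = (5 ^ n + 1) * real_of_int (fibZ (2 * int n + p + q + r + s)) - (-1) powi s * 2 * 5 powr (real n / 2) * real_of_int (fibZ (int n + p + q + r - s)) * c
        - 2 * 5 powr (real n / 2) * c * ((-1) powi r * real_of_int (fibZ (int n + p + q - r + s)) + (-1) powi q * real_of_int (fibZ (p - q)) * real_of_int (lucasZ (int n + r + s)))
        + (-1) powi s * 4 ^ n * ((-1) powi r * real_of_int (fibZ (p + q - r - s)) + (-1) powi q * real_of_int (fibZ (p - q)) * real_of_int (lucasZ (r - s))))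
    \<and> (10 * (\<Sum>k=0..n. real ((2 * n) choose (2 * k)) * real_of_int (lucasZ (int k + p)) * real_of_int (lucasZ (int k + q)) * real_of_int (fibZ (int k + r)) * real_of_int (fibZ (int k + s)))
      = (5 ^ n + 1) * real_of_int (lucasZ (2 * int n + p + q + r + s)) - (-1) powi s * 2 * 5 powr (real n / 2) * real_of_int (lucasZ (int n + p + q + r - s)) * c
        - 2 * 5 powr (real n / 2) * c * ((-1) powi r * real_of_int (lucasZ (int n + p + q - r + s)) - (-1) powi q * real_of_int (lucasZ (p - q)) * real_of_int (lucasZ (int n + r + s)))
        + (-1) powi s * 4 ^ n * ((-1) powi r * real_of_int (lucasZ (p + q - r - s)) - (-1) powi q * real_of_int (lucasZ (p - q)) * real_of_int (lucasZ (r - s))))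
    \<and> (2 * (\<Sum>k=0..n. real ((2 * n) choose (2 * k)) * real_of_int (lucasZ (int k + p)) * real_of_int (lucasZ (int k + q)) * real_of_int (lucasZ (int k + r)) * real_of_int (fibZ (int k + s)))
      = (5 ^ n + 1) * real_of_int (fibZ (2 * int n + p + q + r + s)) - (-1) powi s * 2 * 5 powr (real n / 2) * real_of_int (fibZ (int n + p + q + r - s)) * c
        + 2 * 5 powr (real n / 2) * c * ((-1) powi r * real_of_int (fibZ (int n + p + q - r + s)) + (-1) powi q * real_of_int (lucasZ (p - q)) * real_of_int (fibZ (int n + r + s)))
        - (-1) powi s * 4 ^ n * ((-1) powi r * real_of_int (fibZ (p + q - r - s)) + (-1) powi q * real_of_int (lucasZ (p - q)) * real_of_int (fibZ (r - s))))
    \<and> (2 * (\<Sum>k=0..n. real ((2 * n) choose (2 * k)) * real_of_int (lucasZ (int k + p)) * real_of_int (lucasZ (int k + q)) * real_of_int (lucasZ (int k + r)) * real_of_int (lucasZ (int k + s)))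
      = (5 ^ n + 1) * real_of_int (lucasZ (2 * int n + p + q + r + s)) + (-1) powi s * 2 * 5 powr (real n / 2) * real_of_int (lucasZ (int n + p + q + r - s)) * c
        + 2 * 5 powr (real n / 2) * c * ((-1) powi r * real_of_int (lucasZ (int n + p + q - r + s)) + (-1) powi q * real_of_int (lucasZ (p - q)) * real_of_int (lucasZ (int n + r + s)))
        + (-1) powi s * 4 ^ n * ((-1) powi r * real_of_int (lucasZ (p + q - r - s)) + (-1) powi q * real_of_int (lucasZ (p - q)) * real_of_int (lucasZ (r - s))))"
proof -
  have c: "c = cos (2 * real n * arctan phi)"
    using assms by (simp only: phi_def)
  have h: "5 powr (real n / 2) = sqrt 5 ^ n"
    using powr_powr[of 5 "1 / 2" "real n"] by (simp add: powr_half_sqrt powr_realpow)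
  have sqrt5_sqrt5: "sqrt 5 * (sqrt 5 * x) = 5 * x" for x
    by (simp flip: mult.assoc)
  note nz = less_imp_neq[OF phi_pos, symmetric] psi_nonzero
  have sq: "x powi (2 * int n) = (x ^ n)\<^sup>2" for x :: real
    by (simp add: power_int_mult mult.commute flip: power_mult)
  \<comment> \<open>The expansions that follow express the signed Lucas and Fibonacci numbers of the
    right-hand sides as polynomials in \<open>phi ^ n\<close>, \<open>psi ^ n\<close> and the powers
    with exponents \<open>p\<close>, \<open>q\<close>, \<open>r\<close>, \<open>s\<close>.\<close>
  have L_top: "real_of_int (lucasZ (2 * int n + p + q + r + s))
      = (phi ^ n)\<^sup>2 * (phi powi p * phi powi q * phi powi r * phi powi s)
        + (psi ^ n)\<^sup>2 * (psi powi p * psi powi q * psi powi r * psi powi s)"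
    and F_top: "sqrt 5 * real_of_int (fibZ (2 * int n + p + q + r + s))
      = (phi ^ n)\<^sup>2 * (phi powi p * phi powi q * phi powi r * phi powi s)
        - (psi ^ n)\<^sup>2 * (psi powi p * psi powi q * psi powi r * psi powi s)"
    using nz by (simp_all add: lucasZ_binet fibZ_binet power_int_add sq)
  have L_s: "(-1) powi s * real_of_int (lucasZ (int n + p + q + r - s))
      = phi ^ n * (phi powi p * phi powi q * phi powi r * psi powi s)
        + psi ^ n * (psi powi p * psi powi q * psi powi r * phi powi s)"
    and F_s: "(-1) powi s * (sqrt 5 * real_of_int (fibZ (int n + p + q + r - s)))
      = phi ^ n * (phi powi p * phi powi q * phi powi r * psi powi s)
        - psi ^ n * (psi powi p * psi powi q * psi powi r * phi powi s)"
    unfolding lucasZ_diff fibZ_diff using nz by (simp_all add: power_int_add)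
  \<comment> \<open>The difference lemmas require the subtracted index to come last.\<close>
  have reorder: "int n + p + q - r + s = (int n + p + q + s) - r" by simp
  have L_r: "(-1) powi r * real_of_int (lucasZ (int n + p + q - r + s))
      = phi ^ n * (phi powi p * phi powi q * psi powi r * phi powi s)
        + psi ^ n * (psi powi p * psi powi q * phi powi r * psi powi s)"
    and F_r: "(-1) powi r * (sqrt 5 * real_of_int (fibZ (int n + p + q - r + s)))
      = phi ^ n * (phi powi p * phi powi q * psi powi r * phi powi s)
        - psi ^ n * (psi powi p * psi powi q * phi powi r * psi powi s)"
    unfolding reorder lucasZ_diff fibZ_diff using nz by (simp_all add: power_int_add)
  have L_rs: "(-1) powi s * ((-1) powi r * real_of_int (lucasZ (p + q - r - s)))
      = phi powi p * phi powi q * psi powi r * psi powi s + psi powi p * psi powi q * phi powi r * phi powi s"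
    and F_rs: "(-1) powi s * ((-1) powi r * (sqrt 5 * real_of_int (fibZ (p + q - r - s))))
      = phi powi p * phi powi q * psi powi r * psi powi s - psi powi p * psi powi q * phi powi r * phi powi s"
    \<comment> \<open>Subtracting \<open>r + s\<close> as one index yields both signs at
      once.\<close>
    using lucasZ_diff[of "r + s" "p + q"] fibZ_diff[of "r + s" "p + q"] nz
    by (simp_all add: power_int_add diff_diff_eq mult_ac)
  have L_n: "real_of_int (lucasZ (int n + r + s))
      = phi ^ n * (phi powi r * phi powi s) + psi ^ n * (psi powi r * psi powi s)"
    and F_n: "sqrt 5 * real_of_int (fibZ (int n + r + s))
      = phi ^ n * (phi powi r * phi powi s) - psi ^ n * (psi powi r * psi powi s)"
    using nz by (simp_all add: lucasZ_binet fibZ_binet power_int_add)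
  let ?S0 = "(\<Sum>k=0..n. real ((2 * n) choose (2 * k)) * real_of_int (fibZ (int k + p)) * real_of_int (fibZ (int k + q)) * real_of_int (fibZ (int k + r)) * real_of_int (fibZ (int k + s)))"
  have S0: "50 * ?S0 = (5 ^ n + 1) * real_of_int (lucasZ (2 * int n + p + q + r + s)) - (-1) powi s * 2 * 5 powr (real n / 2) * real_of_int (lucasZ (int n + p + q + r - s)) * c
        - 2 * 5 powr (real n / 2) * c * ((-1) powi r * real_of_int (lucasZ (int n + p + q - r + s)) + (-1) powi q * real_of_int (lucasZ (p - q)) * real_of_int (lucasZ (int n + r + s)))
        + (-1) powi s * 4 ^ n * ((-1) powi r * real_of_int (lucasZ (p + q - r - s)) + (-1) powi q * real_of_int (lucasZ (p - q)) * real_of_int (lucasZ (r - s)))"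
  proof -
    have "50 * ?S0 = 2 * (\<Sum>k=0..n. real ((2 * n) choose (2 * k)) * (sqrt 5 * real_of_int (fibZ (int k + p))) * (sqrt 5 * real_of_int (fibZ (int k + q))) * (sqrt 5 * real_of_int (fibZ (int k + r))) * (sqrt 5 * real_of_int (fibZ (int k + s))))"
      by (simp add: sum_distrib_left sqrt5_sqrt5 mult_ac)
    note sum_expand = trans[OF this even_binomial_sum_quartic[OF \<open>n > 0\<close> c fibZ_shift[of _ p] fibZ_shift[of _ q] fibZ_shift[of _ r] fibZ_shift[of _ s]]]
    \<comment> \<open>Regrouping puts each sign next to the number whose index it belongs to, so
      that the expansions can be substituted.\<close>
    have "((5 ^ n + 1) * real_of_int (lucasZ (2 * int n + p + q + r + s)) - (-1) powi s * 2 * 5 powr (real n / 2) * real_of_int (lucasZ (int n + p + q + r - s)) * c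
        - 2 * 5 powr (real n / 2) * c * ((-1) powi r * real_of_int (lucasZ (int n + p + q - r + s)) + (-1) powi q * real_of_int (lucasZ (p - q)) * real_of_int (lucasZ (int n + r + s)))
        + (-1) powi s * 4 ^ n * ((-1) powi r * real_of_int (lucasZ (p + q - r - s)) + (-1) powi q * real_of_int (lucasZ (p - q)) * real_of_int (lucasZ (r - s))))
      = (5 ^ n + 1) * real_of_int (lucasZ (2 * int n + p + q + r + s))
        - 2 * sqrt 5 ^ n * c * ((-1) powi s * real_of_int (lucasZ (int n + p + q + r - s)))
        - 2 * sqrt 5 ^ n * c * ((-1) powi r * real_of_int (lucasZ (int n + p + q - r + s)) + ((-1) powi q * real_of_int (lucasZ (p - q))) * real_of_int (lucasZ (int n + r + s)))
        + 4 ^ n * ((-1) powi s * ((-1) powi r * real_of_int (lucasZ (p + q - r - s))) + ((-1) powi q * real_of_int (lucasZ (p - q))) * ((-1) powi s * real_of_int (lucasZ (r - s))))"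
      unfolding h by (simp only: algebra_simps)
    \<comment> \<open>Of the six products with two \<open>A\<close> and two \<open>B\<close>, the
      index \<open>p + q - r - s\<close> supplies the two that do not split the pairs; the product
      for \<open>p - q\<close> and \<open>r - s\<close> supplies the other four.\<close>
    also have "\<dots> = 50 * ?S0"
      unfolding sum_expand L_top L_s L_r lucasZ_diff[of q p] L_n L_rs lucasZ_diff[of s r] by algebra
    finally show ?thesis ..
  qed
  let ?S1 = "(\<Sum>k=0..n. real ((2 * n) choose (2 * k)) * real_of_int (lucasZ (int k + p)) * real_of_int (fibZ (int k + q)) * real_of_int (fibZ (int k + r)) * real_of_int (fibZ (int k + s)))"
  have S1: "10 * ?S1 = (5 ^ n + 1) * real_of_int (fibZ (2 * int n + p + q + r + s)) - (-1) powi s * 2 * 5 powr (real n / 2) * real_of_int (fibZ (int n + p + q + r - s)) * c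
        - 2 * 5 powr (real n / 2) * c * ((-1) powi r * real_of_int (fibZ (int n + p + q - r + s)) + (-1) powi q * real_of_int (fibZ (p - q)) * real_of_int (lucasZ (int n + r + s)))
        + (-1) powi s * 4 ^ n * ((-1) powi r * real_of_int (fibZ (p + q - r - s)) + (-1) powi q * real_of_int (fibZ (p - q)) * real_of_int (lucasZ (r - s)))"
  proof -
    \<comment> \<open>Three Fibonacci factors need three roots, so the identity is proved multiplied
      by \<open>sqrt 5\<close>, which is cancelled at the end.\<close>
    have "10 * sqrt 5 * ?S1 = 2 * (\<Sum>k=0..n. real ((2 * n) choose (2 * k)) * real_of_int (lucasZ (int k + p)) * (sqrt 5 * real_of_int (fibZ (int k + q))) * (sqrt 5 * real_of_int (fibZ (int k + r))) * (sqrt 5 * real_of_int (fibZ (int k + s))))"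
      by (simp add: sum_distrib_left sqrt5_sqrt5 mult_ac)
    note sum_expand = trans[OF this even_binomial_sum_quartic[OF \<open>n > 0\<close> c lucasZ_shift[of _ p] fibZ_shift[of _ q] fibZ_shift[of _ r] fibZ_shift[of _ s]]]
    have "sqrt 5 * ((5 ^ n + 1) * real_of_int (fibZ (2 * int n + p + q + r + s)) - (-1) powi s * 2 * 5 powr (real n / 2) * real_of_int (fibZ (int n + p + q + r - s)) * c
        - 2 * 5 powr (real n / 2) * c * ((-1) powi r * real_of_int (fibZ (int n + p + q - r + s)) + (-1) powi q * real_of_int (fibZ (p - q)) * real_of_int (lucasZ (int n + r + s)))
        + (-1) powi s * 4 ^ n * ((-1) powi r * real_of_int (fibZ (p + q - r - s)) + (-1) powi q * real_of_int (fibZ (p - q)) * real_of_int (lucasZ (r - s))))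
      = (5 ^ n + 1) * (sqrt 5 * real_of_int (fibZ (2 * int n + p + q + r + s)))
        - 2 * sqrt 5 ^ n * c * ((-1) powi s * (sqrt 5 * real_of_int (fibZ (int n + p + q + r - s))))
        - 2 * sqrt 5 ^ n * c * ((-1) powi r * (sqrt 5 * real_of_int (fibZ (int n + p + q - r + s))) + ((-1) powi q * (sqrt 5 * real_of_int (fibZ (p - q)))) * real_of_int (lucasZ (int n + r + s)))
        + 4 ^ n * ((-1) powi s * ((-1) powi r * (sqrt 5 * real_of_int (fibZ (p + q - r - s)))) + ((-1) powi q * (sqrt 5 * real_of_int (fibZ (p - q)))) * ((-1) powi s * real_of_int (lucasZ (r - s))))"
      unfolding h by (simp only: algebra_simps)
    \<comment> \<open>The pair \<open>p\<close>, \<open>q\<close> now has one factor of each kind,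
      so its mixed terms form a difference and give \<open>fibZ (p - q)\<close>. The pair
      \<open>r\<close>, \<open>s\<close> is all Fibonacci and still gives Lucas numbers.\<close>
    also have "\<dots> = 10 * sqrt 5 * ?S1"
      unfolding sum_expand F_top F_s F_r fibZ_diff[of q p] L_n F_rs lucasZ_diff[of s r] by algebra
    finally show ?thesis by simp
  qed
  let ?S2 = "(\<Sum>k=0..n. real ((2 * n) choose (2 * k)) * real_of_int (lucasZ (int k + p)) * real_of_int (lucasZ (int k + q)) * real_of_int (fibZ (int k + r)) * real_of_int (fibZ (int k + s)))"
  have S2: "10 * ?S2 = (5 ^ n + 1) * real_of_int (lucasZ (2 * int n + p + q + r + s)) - (-1) powi s * 2 * 5 powr (real n / 2) * real_of_int (lucasZ (int n + p + q + r - s)) * c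
        - 2 * 5 powr (real n / 2) * c * ((-1) powi r * real_of_int (lucasZ (int n + p + q - r + s)) - (-1) powi q * real_of_int (lucasZ (p - q)) * real_of_int (lucasZ (int n + r + s)))
        + (-1) powi s * 4 ^ n * ((-1) powi r * real_of_int (lucasZ (p + q - r - s)) - (-1) powi q * real_of_int (lucasZ (p - q)) * real_of_int (lucasZ (r - s)))"
  proof -
    have "10 * ?S2 = 2 * (\<Sum>k=0..n. real ((2 * n) choose (2 * k)) * real_of_int (lucasZ (int k + p)) * real_of_int (lucasZ (int k + q)) * (sqrt 5 * real_of_int (fibZ (int k + r))) * (sqrt 5 * real_of_int (fibZ (int k + s))))"
      by (simp add: sum_distrib_left sqrt5_sqrt5 mult_ac)
    note sum_expand = trans[OF this even_binomial_sum_quartic[OF \<open>n > 0\<close> c lucasZ_shift[of _ p] lucasZ_shift[of _ q] fibZ_shift[of _ r] fibZ_shift[of _ s]]]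
    have "((5 ^ n + 1) * real_of_int (lucasZ (2 * int n + p + q + r + s)) - (-1) powi s * 2 * 5 powr (real n / 2) * real_of_int (lucasZ (int n + p + q + r - s)) * c
        - 2 * 5 powr (real n / 2) * c * ((-1) powi r * real_of_int (lucasZ (int n + p + q - r + s)) - (-1) powi q * real_of_int (lucasZ (p - q)) * real_of_int (lucasZ (int n + r + s)))
        + (-1) powi s * 4 ^ n * ((-1) powi r * real_of_int (lucasZ (p + q - r - s)) - (-1) powi q * real_of_int (lucasZ (p - q)) * real_of_int (lucasZ (r - s))))
      = (5 ^ n + 1) * real_of_int (lucasZ (2 * int n + p + q + r + s))
        - 2 * sqrt 5 ^ n * c * ((-1) powi s * real_of_int (lucasZ (int n + p + q + r - s)))
        - 2 * sqrt 5 ^ n * c * ((-1) powi r * real_of_int (lucasZ (int n + p + q - r + s)) - ((-1) powi q * real_of_int (lucasZ (p - q))) * real_of_int (lucasZ (int n + r + s)))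
        + 4 ^ n * ((-1) powi s * ((-1) powi r * real_of_int (lucasZ (p + q - r - s))) - ((-1) powi q * real_of_int (lucasZ (p - q))) * ((-1) powi s * real_of_int (lucasZ (r - s))))"
      unfolding h by (simp only: algebra_simps)
    \<comment> \<open>The mixed terms of the Lucas pair \<open>p\<close>, \<open>q\<close> are
      positive and those of the Fibonacci pair \<open>r\<close>, \<open>s\<close> negative, which
      accounts for the inner minus signs.\<close>
    also have "\<dots> = 10 * ?S2"
      unfolding sum_expand L_top L_s L_r lucasZ_diff[of q p] L_n L_rs lucasZ_diff[of s r] by algebra
    finally show ?thesis ..
  qed
  let ?S3 = "(\<Sum>k=0..n. real ((2 * n) choose (2 * k)) * real_of_int (lucasZ (int k + p)) * real_of_int (lucasZ (int k + q)) * real_of_int (lucasZ (int k + r)) * real_of_int (fibZ (int k + s)))"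
  have S3: "2 * ?S3 = (5 ^ n + 1) * real_of_int (fibZ (2 * int n + p + q + r + s)) - (-1) powi s * 2 * 5 powr (real n / 2) * real_of_int (fibZ (int n + p + q + r - s)) * c
        + 2 * 5 powr (real n / 2) * c * ((-1) powi r * real_of_int (fibZ (int n + p + q - r + s)) + (-1) powi q * real_of_int (lucasZ (p - q)) * real_of_int (fibZ (int n + r + s)))
        - (-1) powi s * 4 ^ n * ((-1) powi r * real_of_int (fibZ (p + q - r - s)) + (-1) powi q * real_of_int (lucasZ (p - q)) * real_of_int (fibZ (r - s)))"
  proof -
    have "2 * sqrt 5 * ?S3 = 2 * (\<Sum>k=0..n. real ((2 * n) choose (2 * k)) * real_of_int (lucasZ (int k + p)) * real_of_int (lucasZ (int k + q)) * real_of_int (lucasZ (int k + r)) * (sqrt 5 * real_of_int (fibZ (int k + s))))"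
      by (simp add: sum_distrib_left sqrt5_sqrt5 mult_ac)
    note sum_expand = trans[OF this even_binomial_sum_quartic[OF \<open>n > 0\<close> c lucasZ_shift[of _ p] lucasZ_shift[of _ q] lucasZ_shift[of _ r] fibZ_shift[of _ s]]]
    have "sqrt 5 * ((5 ^ n + 1) * real_of_int (fibZ (2 * int n + p + q + r + s)) - (-1) powi s * 2 * 5 powr (real n / 2) * real_of_int (fibZ (int n + p + q + r - s)) * c
        + 2 * 5 powr (real n / 2) * c * ((-1) powi r * real_of_int (fibZ (int n + p + q - r + s)) + (-1) powi q * real_of_int (lucasZ (p - q)) * real_of_int (fibZ (int n + r + s)))
        - (-1) powi s * 4 ^ n * ((-1) powi r * real_of_int (fibZ (p + q - r - s)) + (-1) powi q * real_of_int (lucasZ (p - q)) * real_of_int (fibZ (r - s))))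
      = (5 ^ n + 1) * (sqrt 5 * real_of_int (fibZ (2 * int n + p + q + r + s)))
        - 2 * sqrt 5 ^ n * c * ((-1) powi s * (sqrt 5 * real_of_int (fibZ (int n + p + q + r - s))))
        + 2 * sqrt 5 ^ n * c * ((-1) powi r * (sqrt 5 * real_of_int (fibZ (int n + p + q - r + s))) + ((-1) powi q * real_of_int (lucasZ (p - q))) * (sqrt 5 * real_of_int (fibZ (int n + r + s))))
        - 4 ^ n * ((-1) powi s * ((-1) powi r * (sqrt 5 * real_of_int (fibZ (p + q - r - s)))) + ((-1) powi q * real_of_int (lucasZ (p - q))) * ((-1) powi s * (sqrt 5 * real_of_int (fibZ (r - s)))))"
      unfolding h by (simp only: algebra_simps)
    \<comment> \<open>Here the pair \<open>r\<close>, \<open>s\<close> has one factor of each kind,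
      hence \<open>fibZ (int n + r + s)\<close> and \<open>fibZ (r - s)\<close>.\<close>
    also have "\<dots> = 2 * sqrt 5 * ?S3"
      unfolding sum_expand F_top F_s F_r lucasZ_diff[of q p] F_n F_rs fibZ_diff[of s r] by algebra
    finally show ?thesis by simp
  qed
  let ?S4 = "(\<Sum>k=0..n. real ((2 * n) choose (2 * k)) * real_of_int (lucasZ (int k + p)) * real_of_int (lucasZ (int k + q)) * real_of_int (lucasZ (int k + r)) * real_of_int (lucasZ (int k + s)))"
  have S4: "2 * ?S4 = (5 ^ n + 1) * real_of_int (lucasZ (2 * int n + p + q + r + s)) + (-1) powi s * 2 * 5 powr (real n / 2) * real_of_int (lucasZ (int n + p + q + r - s)) * c
        + 2 * 5 powr (real n / 2) * c * ((-1) powi r * real_of_int (lucasZ (int n + p + q - r + s)) + (-1) powi q * real_of_int (lucasZ (p - q)) * real_of_int (lucasZ (int n + r + s)))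
        + (-1) powi s * 4 ^ n * ((-1) powi r * real_of_int (lucasZ (p + q - r - s)) + (-1) powi q * real_of_int (lucasZ (p - q)) * real_of_int (lucasZ (r - s)))"
  proof -
    have "2 * ?S4 = 2 * (\<Sum>k=0..n. real ((2 * n) choose (2 * k)) * real_of_int (lucasZ (int k + p)) * real_of_int (lucasZ (int k + q)) * real_of_int (lucasZ (int k + r)) * real_of_int (lucasZ (int k + s)))"
      by (simp add: sum_distrib_left sqrt5_sqrt5 mult_ac)
    note sum_expand = trans[OF this even_binomial_sum_quartic[OF \<open>n > 0\<close> c lucasZ_shift[of _ p] lucasZ_shift[of _ q] lucasZ_shift[of _ r] lucasZ_shift[of _ s]]]
    have "((5 ^ n + 1) * real_of_int (lucasZ (2 * int n + p + q + r + s)) + (-1) powi s * 2 * 5 powr (real n / 2) * real_of_int (lucasZ (int n + p + q + r - s)) * c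
        + 2 * 5 powr (real n / 2) * c * ((-1) powi r * real_of_int (lucasZ (int n + p + q - r + s)) + (-1) powi q * real_of_int (lucasZ (p - q)) * real_of_int (lucasZ (int n + r + s)))
        + (-1) powi s * 4 ^ n * ((-1) powi r * real_of_int (lucasZ (p + q - r - s)) + (-1) powi q * real_of_int (lucasZ (p - q)) * real_of_int (lucasZ (r - s))))
      = (5 ^ n + 1) * real_of_int (lucasZ (2 * int n + p + q + r + s))
        + 2 * sqrt 5 ^ n * c * ((-1) powi s * real_of_int (lucasZ (int n + p + q + r - s)))
        + 2 * sqrt 5 ^ n * c * ((-1) powi r * real_of_int (lucasZ (int n + p + q - r + s)) + ((-1) powi q * real_of_int (lucasZ (p - q))) * real_of_int (lucasZ (int n + r + s)))
        + 4 ^ n * ((-1) powi s * ((-1) powi r * real_of_int (lucasZ (p + q - r - s))) + ((-1) powi q * real_of_int (lucasZ (p - q))) * ((-1) powi s * real_of_int (lucasZ (r - s))))"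
      unfolding h by (simp only: algebra_simps)
    also have "\<dots> = 2 * ?S4"
      unfolding sum_expand L_top L_s L_r lucasZ_diff[of q p] L_n L_rs lucasZ_diff[of s r] by algebra
    finally show ?thesis ..
  qed
  show ?thesis
    using S0 S1 S2 S3 S4 by (intro conjI)
qed

end
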